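(* (i) Let $T=\{T_1,\dots,T_\mu\}$ be a $\mu$-way $(v,k,t)$ trade of volume $m$. Then there exists a $\mu$-way $(v+\mu,k+1,t+1)$ trade $T^*$ of volume $\mu m$ (constructed from $T$ by adjoining $\mu$ new elements $x_1,\dots,x_\mu$ and letting $T^*_j=\bigcup_{i=1}^{\mu}\{B\cup\{x_i\}: B\in T_{i+j-1}\}$, indices of $T$ taken modulo $\mu$ in $\{1,\dots,\mu\}$). (ii) If moreover $T$ is $t$-solely balanced, then this trade $T^*$ is a Steiner trade.
   Context: Let $V$ be a set of $v$ elements and let $k,t$ be positive integers with $t<k<v$. A block is a $k$-subset of $V$. A $\mu$-way $(v,k,t)$ trade of volume $m$ ($\mu\geq 2$) is a family $T=\{T_1,\dots,T_\mu\}$ of $\mu$ pairwise disjoint collections of blocks, each $T_i$ consisting of exactly $m$ blocks, such that for every $t$-subset $S$ of $V$, the number of blocks of $T_i$ containing $S$ is the same for all $i$. It is a Steiner trade if every $t$-subset of $V$ is contained in at most one block of each $T_i$. A $\mu$-way $(v,k,t)$ Steiner trade $T$ is called $t$-solely balanced if for all $1\le i<j\le\mu$, no $(t+1)$-subset of $V$ is contained both in a block of $T_i$ and in a block of $T_j$. *)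

theory Defs
  imports Main "HOL-Library.Disjoint_Sets"
begin

text \<open>
  A family \<open>{T\<^sub>1, \<dots>, T\<^sub>\<mu>}\<close> is represented by a function \<open>T\<close> on indices, of which only the values
  on \<open>{1..\<mu>}\<close> matter. Collections of blocks are sets, i.e. without repeated blocks.
\<close>

definition mu_way_trade ::
  "nat \<Rightarrow> nat \<Rightarrow> nat \<Rightarrow> nat \<Rightarrow> nat \<Rightarrow> 'a set \<Rightarrow> (nat \<Rightarrow> 'a set set) \<Rightarrow> bool" where
  "mu_way_trade \<mu> v k t m V T \<longleftrightarrow>
     2 \<le> \<mu> \<and> 0 < t \<and> t < k \<and> k < v \<and> finite V \<and> card V = v \<and>
     (\<forall>i\<in>{1..\<mu>}. (\<forall>B\<in>T i. B \<subseteq> V \<and> card B = k) \<and> card (T i) = m) \<and>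
     disjoint_family_on T {1..\<mu>} \<and>
     (\<forall>S. S \<subseteq> V \<and> card S = t \<longrightarrow>
        (\<forall>i\<in>{1..\<mu>}. \<forall>j\<in>{1..\<mu>}. card {B \<in> T i. S \<subseteq> B} = card {B \<in> T j. S \<subseteq> B}))"

definition mu_way_steiner_trade ::
  "nat \<Rightarrow> nat \<Rightarrow> nat \<Rightarrow> nat \<Rightarrow> nat \<Rightarrow> 'a set \<Rightarrow> (nat \<Rightarrow> 'a set set) \<Rightarrow> bool" where
  "mu_way_steiner_trade \<mu> v k t m V T \<longleftrightarrow>
     mu_way_trade \<mu> v k t m V T \<and>
     (\<forall>S. S \<subseteq> V \<and> card S = t \<longrightarrow> (\<forall>i\<in>{1..\<mu>}. card {B \<in> T i. S \<subseteq> B} \<le> 1))"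

definition solely_balanced ::
  "nat \<Rightarrow> nat \<Rightarrow> nat \<Rightarrow> nat \<Rightarrow> nat \<Rightarrow> 'a set \<Rightarrow> (nat \<Rightarrow> 'a set set) \<Rightarrow> bool" where
  "solely_balanced \<mu> v k t m V T \<longleftrightarrow>
     mu_way_steiner_trade \<mu> v k t m V T \<and>
     (\<forall>i j. 1 \<le> i \<and> i < j \<and> j \<le> \<mu> \<longrightarrow>
        \<not> (\<exists>S. S \<subseteq> V \<and> card S = t + 1 \<and> (\<exists>B\<in>T i. S \<subseteq> B) \<and> (\<exists>C\<in>T j. S \<subseteq> C)))"

text \<open>
  For \<open>i, j \<ge> 1\<close>, \<open>(i + j - 2) mod \<mu> + 1\<close> is the representative of \<open>i + j - 1\<close> modulo \<open>\<mu>\<close>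
  in \<open>{1..\<mu>}\<close>.
\<close>

definition star_trade ::
  "nat \<Rightarrow> (nat \<Rightarrow> 'a) \<Rightarrow> (nat \<Rightarrow> 'a set set) \<Rightarrow> nat \<Rightarrow> 'a set set" where
  "star_trade \<mu> x T j =
     (\<Union>i\<in>{1..\<mu>}. {B \<union> {x i} | B. B \<in> T ((i + j - 2) mod \<mu> + 1)})"

text \<open>
  \<open>x\<close> lists \<open>\<mu>\<close> distinct elements outside \<open>V\<close>.
\<close>

definition new_elements :: "nat \<Rightarrow> 'a set \<Rightarrow> (nat \<Rightarrow> 'a) \<Rightarrow> bool" where
  "new_elements \<mu> V x \<longleftrightarrow> inj_on x {1..\<mu>} \<and> x ` {1..\<mu>} \<inter> V = {}"

text \<open>
  A finite type may have no room for \<open>\<mu>\<close> new elements, so existence is stated over \<open>'a + nat\<close>,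
  into which \<open>V\<close> and the blocks are transported along \<open>Inl\<close>.
\<close>

definition lift_family :: "(nat \<Rightarrow> 'a set set) \<Rightarrow> nat \<Rightarrow> ('a + nat) set set" where
  "lift_family T i = (\<lambda>B. Inl ` B) ` T i"

end

theory Submission
  imports Defs
begin

text \<open>
  A block of \<open>T\<^sup>*\<^sub>j\<close> contains exactly one new element, so the blocks of \<open>T\<^sup>*\<^sub>j\<close> over a set \<open>S\<close> can be
  counted separately for each new element \<open>x\<^sub>i\<close>. If \<open>S \<subseteq> V\<close>, the count is the total over all of
  \<open>T\<^sub>1, \<dots>, T\<^sub>\<mu>\<close>, since \<open>i \<mapsto> i + j - 1\<close> permutes the residues modulo \<open>\<mu>\<close>; sole balancedness lets
  at most one block contribute to it. If \<open>x\<^sub>i \<in> S\<close>, only the \<open>i\<close>-th part contributes, and it counts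
  the blocks of a single collection of \<open>T\<close> over \<open>S - {x\<^sub>i}\<close>.
\<close>

section \<open>The cyclic shift of indices\<close>

lemma shift_index_inj:
  fixes i i' j \<mu> :: nat
  assumes "i \<in> {1..\<mu>}" "i' \<in> {1..\<mu>}" "1 \<le> j"
    and "(i + j - 2) mod \<mu> = (i' + j - 2) mod \<mu>"
  shows "i = i'"
proof -
  \<comment> \<open>Since subtraction on \<open>nat\<close> truncates, one order of the two indices
    is fixed first; the other follows by symmetry.\<close>
  have *: "a = b" if "a \<in> {1..\<mu>}" "b \<in> {1..\<mu>}" "b \<le> a"
      "(a + j - 2) mod \<mu> = (b + j - 2) mod \<mu>" for a b
  proof -
    have "b + j - 2 \<le> a + j - 2" using that(3) by simp
    then have "\<mu> dvd (a + j - 2) - (b + j - 2)"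
      using mod_eq_dvd_iff_nat that(4) by blast
    \<comment> \<open>Both indices and \<open>j\<close> are at least 1, so subtracting 2 never
      truncates and \<open>j\<close> cancels.\<close>
    moreover have "(a + j - 2) - (b + j - 2) = a - b"
      using that assms(3) by auto
    ultimately have "\<mu> dvd a - b" by simp
    moreover have "a - b < \<mu>" using that by auto
    ultimately have "a - b = 0" using nat_dvd_not_less by blast
    then show ?thesis using that by simp
  qed
  show ?thesis
    using *[of i i'] *[of i' i] assms by (metis nat_le_linear)
qed

text \<open>An injective self-map of a finite set is onto. This allows a sum over the shifted
  collections to be reindexed as a sum over \<open>T\<close> itself.\<close>

lemma bij_betw_shift_index:
  fixes j \<mu> :: nat
  assumes "1 \<le> j"
  shows "bij_betw (\<lambda>i. (i + j - 2) mod \<mu> + 1) {1..\<mu>} {1..\<mu>}"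
proof -
  have inj: "inj_on (\<lambda>i. (i + j - 2) mod \<mu> + 1) {1..\<mu>}"
    using shift_index_inj assms by (intro inj_onI) auto
  moreover have "(\<lambda>i. (i + j - 2) mod \<mu> + 1) ` {1..\<mu>} \<subseteq> {1..\<mu>}"
    by (auto simp: Suc_le_eq)
  ultimately have "(\<lambda>i. (i + j - 2) mod \<mu> + 1) ` {1..\<mu>} = {1..\<mu>}"
    by (intro endo_inj_surj) auto
  with inj show ?thesis by (simp add: bij_betw_def)
qed

lemma shift_index_in:
  fixes i \<mu> :: nat
  shows "i \<in> {1..\<mu>} \<Longrightarrow> (i + j - 2) mod \<mu> + 1 \<in> {1..\<mu>}"
  by (auto simp: Suc_le_eq)

section \<open>Working rules for trades and new elements\<close>

lemma mu_way_tradeD: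
  assumes "mu_way_trade \<mu> v k t m V T"
  shows "2 \<le> \<mu>" "0 < t" "t < k" "k < v" "finite V" "card V = v"
    and "i \<in> {1..\<mu>} \<Longrightarrow> B \<in> T i \<Longrightarrow> B \<subseteq> V"
    and "i \<in> {1..\<mu>} \<Longrightarrow> B \<in> T i \<Longrightarrow> card B = k"
    and "i \<in> {1..\<mu>} \<Longrightarrow> card (T i) = m"
    and "i \<in> {1..\<mu>} \<Longrightarrow> j \<in> {1..\<mu>} \<Longrightarrow> i \<noteq> j \<Longrightarrow> T i \<inter> T j = {}"
    and "S \<subseteq> V \<Longrightarrow> card S = t \<Longrightarrow> i \<in> {1..\<mu>} \<Longrightarrow> j \<in> {1..\<mu>} \<Longrightarrow>
      card {B \<in> T i. S \<subseteq> B} = card {B \<in> T j. S \<subseteq> B}"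
  using assms unfolding mu_way_trade_def disjoint_family_on_def by (blast+)

lemma mu_way_tradeI:
  assumes "2 \<le> \<mu>" "0 < t" "t < k" "k < v" "finite V" "card V = v"
    and "\<And>i B. i \<in> {1..\<mu>} \<Longrightarrow> B \<in> T i \<Longrightarrow> B \<subseteq> V \<and> card B = k"
    and "\<And>i. i \<in> {1..\<mu>} \<Longrightarrow> card (T i) = m"
    and "\<And>i j. i \<in> {1..\<mu>} \<Longrightarrow> j \<in> {1..\<mu>} \<Longrightarrow> i \<noteq> j \<Longrightarrow> T i \<inter> T j = {}"
    and "\<And>S i j. S \<subseteq> V \<Longrightarrow> card S = t \<Longrightarrow> i \<in> {1..\<mu>} \<Longrightarrow> j \<in> {1..\<mu>} \<Longrightarrow>
      card {B \<in> T i. S \<subseteq> B} = card {B \<in> T j. S \<subseteq> B}"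
  shows "mu_way_trade \<mu> v k t m V T"
  unfolding mu_way_trade_def disjoint_family_on_def
proof (intro conjI ballI allI impI)
  show "card {B \<in> T i. S \<subseteq> B} = card {B \<in> T j. S \<subseteq> B}"
    if "S \<subseteq> V \<and> card S = t" "i \<in> {1..\<mu>}" "j \<in> {1..\<mu>}" for S i j
    using assms(10) that by blast
qed (use assms(1-9) in auto)

lemma mu_way_trade_finite:
  assumes "mu_way_trade \<mu> v k t m V T" "i \<in> {1..\<mu>}"
  shows "finite (T i)"
proof (rule finite_subset)
  show "T i \<subseteq> Pow V" using mu_way_tradeD(7)[OF assms] by blast
  show "finite (Pow V)" using mu_way_tradeD(5)[OF assms(1)] by simp
qed

lemma new_elementsD:
  assumes "new_elements \<mu> V x"
  shows "i \<in> {1..\<mu>} \<Longrightarrow> x i \<notin> V"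
    and "i \<in> {1..\<mu>} \<Longrightarrow> j \<in> {1..\<mu>} \<Longrightarrow> x i = x j \<Longrightarrow> i = j"
  using assms unfolding new_elements_def inj_on_def by blast+

section \<open>Counting blocks of the star collections\<close>

lemma star_trade_eq:
  "star_trade \<mu> x T j = (\<Union>i\<in>{1..\<mu>}. insert (x i) ` T ((i + j - 2) mod \<mu> + 1))"
  unfolding star_trade_def by auto

text \<open>The inserted element is the only one outside \<open>V\<close>, so it can be recognised
  in the block and removed again; distinctness of the new elements then recovers its index.\<close>

lemma insert_new_element_eq_iff:
  assumes "new_elements \<mu> V x" "i \<in> {1..\<mu>}" "i' \<in> {1..\<mu>}" "B \<subseteq> V" "B' \<subseteq> V"
  shows "insert (x i) B = insert (x i') B' \<longleftrightarrow> i = i' \<and> B = B'"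
proof
  assume eq: "insert (x i) B = insert (x i') B'"
  have "x i \<notin> V" "x i' \<notin> V" using new_elementsD(1)[OF assms(1)] assms(2,3) by auto
  then have out: "x i \<notin> B" "x i \<notin> B'" "x i' \<notin> B" "x i' \<notin> B'" using assms(4,5) by auto
  with eq have "x i = x i'" by blast
  then have "i = i'" using new_elementsD(2)[OF assms(1)] assms(2,3) by blast
  with eq out show "i = i' \<and> B = B'" by (simp add: insert_ident)
qed simp

text \<open>The parts belonging to different new elements are disjoint, and inserting
  \<open>x i\<close> is injective on subsets of \<open>V\<close>, so cardinalities add up. The
  predicate is left arbitrary to cover both counts over a set \<open>S\<close> and, with a
  constantly true \<open>P\<close>, the volume.\<close>

lemma card_star_trade_filter:
  assumes T: "mu_way_trade \<mu> v k t m V T" and x: "new_elements \<mu> V x"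
  shows "card {B \<in> star_trade \<mu> x T j. P B} =
    (\<Sum>i\<in>{1..\<mu>}. card {B \<in> T ((i + j - 2) mod \<mu> + 1). P (insert (x i) B)})"
proof -
  let ?s = "\<lambda>i. (i + j - 2) mod \<mu> + 1"
  let ?A = "\<lambda>i. {B \<in> T (?s i). P (insert (x i) B)}"
  have sub: "B \<subseteq> V" if "i \<in> {1..\<mu>}" "B \<in> ?A i" for i B
    using mu_way_tradeD(7)[OF T shift_index_in] that by blast
  have fin: "finite (?A i)" if "i \<in> {1..\<mu>}" for i
    using mu_way_trade_finite[OF T shift_index_in] that by simp
  have "{B \<in> star_trade \<mu> x T j. P B} = (\<Union>i\<in>{1..\<mu>}. insert (x i) ` ?A i)"
    unfolding star_trade_eq by auto
  also have "card \<dots> = (\<Sum>i\<in>{1..\<mu>}. card (insert (x i) ` ?A i))"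
  proof (rule card_UN_disjoint)
    show "\<forall>i\<in>{1..\<mu>}. \<forall>i'\<in>{1..\<mu>}. i \<noteq> i' \<longrightarrow>
        insert (x i) ` ?A i \<inter> insert (x i') ` ?A i' = {}"
    proof (intro ballI impI, rule ccontr)
      fix i i' assume i: "i \<in> {1..\<mu>}" "i' \<in> {1..\<mu>}" "i \<noteq> i'"
        and "insert (x i) ` ?A i \<inter> insert (x i') ` ?A i' \<noteq> {}"
      then obtain B B' where "B \<in> ?A i" "B' \<in> ?A i'" "insert (x i) B = insert (x i') B'"
        by blast
      with i show False
        using insert_new_element_eq_iff[OF x i(1,2)] sub by metis
    qed
  qed (use fin in auto)
  also have "\<dots> = (\<Sum>i\<in>{1..\<mu>}. card (?A i))"
  proof (rule sum.cong[OF refl], rule card_image, rule inj_onI)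
    fix i B B' assume "i \<in> {1..\<mu>}" "B \<in> ?A i" "B' \<in> ?A i" "insert (x i) B = insert (x i) B'"
    then show "B = B'" using insert_new_element_eq_iff[OF x] sub by metis
  qed
  finally show ?thesis .
qed

text \<open>A new element does not help to cover a subset of \<open>V\<close>, so each part counts
  old blocks over \<open>S\<close>, and the shift merely permutes the summands. The right-hand side
  is free of \<open>j\<close>, which is the balance condition for such \<open>S\<close>.\<close>

lemma card_star_trade_over_old:
  assumes T: "mu_way_trade \<mu> v k t m V T" and x: "new_elements \<mu> V x"
    and S: "S \<subseteq> V" and j: "1 \<le> j"
  shows "card {B \<in> star_trade \<mu> x T j. S \<subseteq> B} = (\<Sum>i\<in>{1..\<mu>}. card {B \<in> T i. S \<subseteq> B})"
proof -
  have "S \<subseteq> insert (x i) B \<longleftrightarrow> S \<subseteq> B" if "i \<in> {1..\<mu>}" for i B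
    using new_elementsD(1)[OF x that] S by blast
  then have "card {B \<in> star_trade \<mu> x T j. S \<subseteq> B} =
      (\<Sum>i\<in>{1..\<mu>}. card {B \<in> T ((i + j - 2) mod \<mu> + 1). S \<subseteq> B})"
    unfolding card_star_trade_filter[OF T x] by (intro sum.cong) auto
  also have "\<dots> = (\<Sum>i\<in>{1..\<mu>}. card {B \<in> T i. S \<subseteq> B})"
    by (rule sum.reindex_bij_betw[OF bij_betw_shift_index[OF j],
          of "\<lambda>i. card {B \<in> T i. S \<subseteq> B}"])
  finally show ?thesis .
qed

text \<open>Blocks from any other part miss \<open>x i\<close>, so a single summand survives. The
  set \<open>S\<close> may contain further new elements; both sides are then 0.\<close>

lemma card_star_trade_over_new:
  assumes T: "mu_way_trade \<mu> v k t m V T" and x: "new_elements \<mu> V x"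
    and i: "i \<in> {1..\<mu>}" "x i \<in> S"
  shows "card {B \<in> star_trade \<mu> x T j. S \<subseteq> B} =
    card {B \<in> T ((i + j - 2) mod \<mu> + 1). S - {x i} \<subseteq> B}"
proof -
  have "{B \<in> T ((i' + j - 2) mod \<mu> + 1). S \<subseteq> insert (x i') B} =
      (if i' = i then {B \<in> T ((i + j - 2) mod \<mu> + 1). S - {x i} \<subseteq> B} else {})"
    if i': "i' \<in> {1..\<mu>}" for i'
  proof (cases "i' = i")
    case False
    have "x i \<notin> insert (x i') B" if "B \<in> T ((i' + j - 2) mod \<mu> + 1)" for B
    proof -
      have "x i \<notin> B"
        using mu_way_tradeD(7)[OF T shift_index_in[OF i'] that] new_elementsD(1)[OF x i(1)] by blast
      moreover have "x i \<noteq> x i'" using new_elementsD(2)[OF x i(1) i'] False by blast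
      ultimately show ?thesis by blast
    qed
    with False i(2) show ?thesis by auto
  qed auto
  then have "card {B \<in> star_trade \<mu> x T j. S \<subseteq> B} = (\<Sum>i'\<in>{1..\<mu>}.
      if i' = i then card {B \<in> T ((i + j - 2) mod \<mu> + 1). S - {x i} \<subseteq> B} else 0)"
    unfolding card_star_trade_filter[OF T x] by (intro sum.cong) auto
  then show ?thesis using i(1) by simp
qed

section \<open>Trade and Steiner properties of the star collections\<close>

lemma filter_superset_empty:
  assumes "mu_way_trade \<mu> v k t m V T" "i \<in> {1..\<mu>}" "\<not> S \<subseteq> V"
  shows "{B \<in> T i. S \<subseteq> B} = {}"
  using mu_way_tradeD(7)[OF assms(1,2)] assms(3) by blast

text \<open>A block common to two star collections would come from one old block lying in two
  collections of \<open>T\<close>. Balance over a set with a new element reduces to balance of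
  \<open>T\<close> over the \<open>t\<close> remaining elements, or to two zero counts.\<close>

lemma star_trade_is_trade:
  assumes T: "mu_way_trade \<mu> v k t m V T" and x: "new_elements \<mu> V x"
  shows "mu_way_trade \<mu> (v + \<mu>) (k + 1) (t + 1) (\<mu> * m) (V \<union> x ` {1..\<mu>}) (star_trade \<mu> x T)"
proof -
  note TD = mu_way_tradeD[OF T]
  have cardV: "card (V \<union> x ` {1..\<mu>}) = v + \<mu>"
  proof -
    have "card (x ` {1..\<mu>}) = \<mu>" "V \<inter> x ` {1..\<mu>} = {}"
      using x card_image[of x "{1..\<mu>}"] unfolding new_elements_def by auto
    then show ?thesis using TD(5,6) by (simp add: card_Un_disjoint)
  qed
  have block: "B \<subseteq> V \<union> x ` {1..\<mu>} \<and> card B = k + 1" if B: "B \<in> star_trade \<mu> x T j" for j B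
  proof -
    obtain i C where i: "i \<in> {1..\<mu>}" and C: "C \<in> T ((i + j - 2) mod \<mu> + 1)"
      and eq: "B = insert (x i) C"
      using B unfolding star_trade_eq by blast
    have "C \<subseteq> V" "card C = k" using TD(7,8)[OF shift_index_in[OF i] C] .
    moreover have "finite C" using \<open>C \<subseteq> V\<close> TD(5) finite_subset by blast
    moreover have "x i \<notin> C" using new_elementsD(1)[OF x i] \<open>C \<subseteq> V\<close> by blast
    ultimately show ?thesis using i eq by auto
  qed
  have size: "card (star_trade \<mu> x T j) = \<mu> * m" for j
  proof -
    have "card (star_trade \<mu> x T j) = (\<Sum>i\<in>{1..\<mu>}. card (T ((i + j - 2) mod \<mu> + 1)))"
      using card_star_trade_filter[OF T x, of j "\<lambda>_. True"] by simp
    also have "\<dots> = (\<Sum>i\<in>{1..\<mu>}. m)"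
      by (intro sum.cong refl TD(9) shift_index_in)
    finally show ?thesis by simp
  qed
  have disj: "star_trade \<mu> x T j \<inter> star_trade \<mu> x T j' = {}"
    if j: "j \<in> {1..\<mu>}" "j' \<in> {1..\<mu>}" "j \<noteq> j'" for j j'
  proof (rule ccontr)
    assume "star_trade \<mu> x T j \<inter> star_trade \<mu> x T j' \<noteq> {}"
    then obtain i i' C C' where i: "i \<in> {1..\<mu>}" "i' \<in> {1..\<mu>}"
      and C: "C \<in> T ((i + j - 2) mod \<mu> + 1)" and C': "C' \<in> T ((i' + j' - 2) mod \<mu> + 1)"
      and "insert (x i) C = insert (x i') C'"
      unfolding star_trade_eq by blast
    then have "i = i'" "C = C'"
      using insert_new_element_eq_iff[OF x i] TD(7)[OF shift_index_in[OF i(1)] C]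
        TD(7)[OF shift_index_in[OF i(2)] C'] by blast+
    \<comment> \<open>The old block \<open>C\<close> lies in both collections, and distinct
      collections of \<open>T\<close> are disjoint, so the two shifted indices agree.\<close>
    with C C' have "(i + j - 2) mod \<mu> + 1 = (i + j' - 2) mod \<mu> + 1"
      using TD(10)[OF shift_index_in[OF i(1)] shift_index_in[OF i(1)], of j j'] by blast
    \<comment> \<open>The shift is symmetric in its two arguments, so its injectivity also applies
      to \<open>j\<close> with \<open>i\<close> held fixed.\<close>
    then show False
      using shift_index_inj[of j \<mu> j' i] i j by (simp add: add.commute)
  qed
  have balanced: "card {B \<in> star_trade \<mu> x T j. S \<subseteq> B} = card {B \<in> star_trade \<mu> x T j'. S \<subseteq> B}"
    if S: "S \<subseteq> V \<union> x ` {1..\<mu>}" "card S = t + 1" and j: "j \<in> {1..\<mu>}" "j' \<in> {1..\<mu>}" for S j j'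
  proof (cases "S \<subseteq> V")
    case True
    then show ?thesis using card_star_trade_over_old[OF T x True] j by simp
  next
    case False
    then obtain i where i: "i \<in> {1..\<mu>}" "x i \<in> S" using S(1) by blast
    have "card {B \<in> T ((i + j - 2) mod \<mu> + 1). S - {x i} \<subseteq> B} =
        card {B \<in> T ((i + j' - 2) mod \<mu> + 1). S - {x i} \<subseteq> B}"
    proof (cases "S - {x i} \<subseteq> V")
      case True
      moreover have "card (S - {x i}) = t" using S(2) i(2) by simp
      ultimately show ?thesis using TD(11) shift_index_in[OF i(1)] by blast
    next
      \<comment> \<open>Here \<open>S\<close> contains a second new element, which no block of
        \<open>T\<close> can cover, so both counts vanish.\<close>
      case False
      then show ?thesis
        by (simp only: filter_superset_empty[OF T shift_index_in[OF i(1)] False])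
    qed
    then show ?thesis by (simp only: card_star_trade_over_new[OF T x i])
  qed
  show ?thesis
  proof (rule mu_way_tradeI)
    show "finite (V \<union> x ` {1..\<mu>})" using TD(5) by simp
    show "t + 1 < k + 1" "k + 1 < v + \<mu>" using TD(1,3,4) by auto
  qed (use TD(1) in simp, simp, (rule cardV block size disj balanced; assumption)+)
qed

text \<open>For \<open>S\<close> inside \<open>V\<close>, sole balance leaves at most one collection
  of \<open>T\<close> with blocks over \<open>S\<close>, and the Steiner property leaves at most one
  block in it. If \<open>S\<close> contains a new element, the Steiner property of \<open>T\<close>
  bounds the one surviving count directly.\<close>

lemma star_trade_is_steiner:
  assumes sb: "solely_balanced \<mu> v k t m V T" and x: "new_elements \<mu> V x"
  shows "mu_way_steiner_trade \<mu> (v + \<mu>) (k + 1) (t + 1) (\<mu> * m)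
    (V \<union> x ` {1..\<mu>}) (star_trade \<mu> x T)"
proof -
  have steiner: "card {B \<in> T i. S \<subseteq> B} \<le> 1" if "S \<subseteq> V" "card S = t" "i \<in> {1..\<mu>}" for S i
    using sb that unfolding solely_balanced_def mu_way_steiner_trade_def by auto
  have T: "mu_way_trade \<mu> v k t m V T"
    using sb unfolding solely_balanced_def mu_way_steiner_trade_def by auto
  \<comment> \<open>The ordered condition \<open>i < j\<close> of the definition is turned into a
    symmetric uniqueness statement for the index.\<close>
  have solely: "i = j"
    if "S \<subseteq> V" "card S = t + 1" "i \<in> {1..\<mu>}" "j \<in> {1..\<mu>}" "B \<in> T i" "S \<subseteq> B" "C \<in> T j" "S \<subseteq> C"
    for S i j B C
  proof -
    have less: False
      if "1 \<le> a" "a < b" "b \<le> \<mu>" "X \<in> T a" "S \<subseteq> X" "Y \<in> T b" "S \<subseteq> Y" for a b X Y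
      using sb that \<open>S \<subseteq> V\<close> \<open>card S = t + 1\<close> unfolding solely_balanced_def by blast
    show ?thesis using less[of i j B C] less[of j i C B] that by (cases i j rule: linorder_cases) auto
  qed
  have "card {B \<in> star_trade \<mu> x T j. S \<subseteq> B} \<le> 1"
    if S: "S \<subseteq> V \<union> x ` {1..\<mu>}" "card S = t + 1" and j: "j \<in> {1..\<mu>}" for S j
  proof (cases "S \<subseteq> V")
    case True
    have one: "card {B \<in> T i. S \<subseteq> B} \<le> 1" if i: "i \<in> {1..\<mu>}" for i
    proof -
      \<comment> \<open>The Steiner property of \<open>T\<close> concerns \<open>t\<close>-sets
        while \<open>S\<close> has \<open>t + 1\<close> elements; every block over \<open>S\<close>
        is also a block over the smaller set \<open>R\<close>.\<close>
      obtain R where R: "R \<subseteq> S" "card R = t"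
        using obtain_subset_with_card_n[of t S] S(2) by auto
      have "card {B \<in> T i. S \<subseteq> B} \<le> card {B \<in> T i. R \<subseteq> B}"
        using R(1) mu_way_trade_finite[OF T i] by (intro card_mono) auto
      also have "\<dots> \<le> 1" using steiner R True i by blast
      finally show ?thesis .
    qed
    show ?thesis
    proof (cases "\<exists>i\<in>{1..\<mu>}. \<exists>B\<in>T i. S \<subseteq> B")
      case hit: True
      then obtain i B where i: "i \<in> {1..\<mu>}" "B \<in> T i" "S \<subseteq> B" by blast
      \<comment> \<open>Once \<open>T i\<close> has a block over \<open>S\<close>, all other
        collections contribute 0 and the sum collapses to the term at \<open>i\<close>.\<close>
      have "card {B \<in> T i'. S \<subseteq> B} = (if i' = i then card {B \<in> T i. S \<subseteq> B} else 0)"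
        if i': "i' \<in> {1..\<mu>}" for i'
      proof (cases "i' = i")
        case False
        then have "{B \<in> T i'. S \<subseteq> B} = {}" using solely[OF True S(2) i(1) i' i(2,3)] by blast
        then have "card {B \<in> T i'. S \<subseteq> B} = 0" by (simp only: card.empty)
        then show ?thesis using False by simp
      qed simp
      then have "(\<Sum>i'\<in>{1..\<mu>}. card {B \<in> T i'. S \<subseteq> B}) =
          (\<Sum>i'\<in>{1..\<mu>}. if i' = i then card {B \<in> T i. S \<subseteq> B} else 0)"
        by (intro sum.cong refl)
      also have "\<dots> = card {B \<in> T i. S \<subseteq> B}" using i(1) by simp
      also have "\<dots> \<le> 1" using one i(1) .
      finally show ?thesis using card_star_trade_over_old[OF T x True] j by simp
    next
      case False
      then have "{B \<in> T i. S \<subseteq> B} = {}" if "i \<in> {1..\<mu>}" for i using that by blast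
      then have "(\<Sum>i\<in>{1..\<mu>}. card {B \<in> T i. S \<subseteq> B}) = 0"
        by (intro sum.neutral ballI) (simp only: card.empty)
      then show ?thesis using card_star_trade_over_old[OF T x True] j by simp
    qed
  next
    case False
    then obtain i where i: "i \<in> {1..\<mu>}" "x i \<in> S" using S(1) by blast
    have "card {B \<in> T ((i + j - 2) mod \<mu> + 1). S - {x i} \<subseteq> B} \<le> 1"
    proof (cases "S - {x i} \<subseteq> V")
      case True
      moreover have "card (S - {x i}) = t" using S(2) i(2) by simp
      ultimately show ?thesis using steiner shift_index_in[OF i(1)] by blast
    next
      case False
      then show ?thesis
        by (simp only: filter_superset_empty[OF T shift_index_in[OF i(1)] False] card.empty)
    qed
    then show ?thesis by (simp only: card_star_trade_over_new[OF T x i])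
  qed
  with star_trade_is_trade[OF T x] show ?thesis
    unfolding mu_way_steiner_trade_def by blast
qed

section \<open>Transport along \<open>Inl\<close>\<close>

lemma card_lift_family_filter:
  "card {B \<in> lift_family T i. Inl ` S \<subseteq> B} = card {B \<in> T i. S \<subseteq> B}"
proof -
  \<comment> \<open>Injectivity of \<open>Inl\<close> makes containment of images equivalent to
    containment, and makes the image map on blocks injective.\<close>
  have "{B \<in> lift_family T i. Inl ` S \<subseteq> B} = (`) Inl ` {B \<in> T i. S \<subseteq> B}"
    unfolding lift_family_def by (auto simp: inj_image_subset_iff)
  then show ?thesis
    by (simp add: card_image inj_on_def inj_image_eq_iff)
qed

text \<open>Each subset of the transported ground set is the image of a subset of \<open>V\<close>
  of equal size, so every condition can be pulled back to \<open>T\<close>.\<close>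

lemma lift_family_is_trade:
  assumes T: "mu_way_trade \<mu> v k t m V T"
  shows "mu_way_trade \<mu> v k t m (Inl ` V) (lift_family T)"
proof -
  note TD = mu_way_tradeD[OF T]
  have size: "card (lift_family T i) = m" if "i \<in> {1..\<mu>}" for i
    \<comment> \<open>Every block contains the empty set, so the count over \<open>{}\<close> is the
      volume.\<close>
    using card_lift_family_filter[of T i "{}"] TD(9)[OF that] by simp
  have block: "B \<subseteq> Inl ` V \<and> card B = k" if i: "i \<in> {1..\<mu>}" and B: "B \<in> lift_family T i" for i B
  proof -
    obtain C where C: "C \<in> T i" "B = Inl ` C" using B unfolding lift_family_def by blast
    then show ?thesis using TD(7,8)[OF i C(1)] by (auto simp: card_image)
  qed
  have disj: "lift_family T i \<inter> lift_family T j = {}"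
    if "i \<in> {1..\<mu>}" "j \<in> {1..\<mu>}" "i \<noteq> j" for i j
    using TD(10)[OF that] unfolding lift_family_def by (auto simp: inj_image_eq_iff)
  have balanced: "card {B \<in> lift_family T i. S \<subseteq> B} = card {B \<in> lift_family T j. S \<subseteq> B}"
    if S: "S \<subseteq> Inl ` V" "card S = t" and ij: "i \<in> {1..\<mu>}" "j \<in> {1..\<mu>}" for S i j
  proof -
    obtain R where R: "R \<subseteq> V" "S = Inl ` R" using S(1) by (auto simp: subset_image_iff)
    then have "card R = t" using S(2) by (simp add: card_image)
    then show ?thesis unfolding R(2) card_lift_family_filter using TD(11) R(1) ij by blast
  qed
  show ?thesis
  proof (rule mu_way_tradeI)
    show "finite (Inl ` V)" using TD(5) by simp
    show "card (Inl ` V) = v" using TD(6) by (simp add: card_image)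
  qed (fact TD(1-4) size block disj balanced)+
qed

lemma lift_family_solely_balanced:
  assumes sb: "solely_balanced \<mu> v k t m V T"
  shows "solely_balanced \<mu> v k t m (Inl ` V) (lift_family T)"
proof -
  have pull: "\<exists>R. R \<subseteq> V \<and> S = Inl ` R \<and> card R = card S" if "S \<subseteq> Inl ` V" for S :: "('a + nat) set"
    using that by (auto simp: subset_image_iff card_image)
  have steiner: "card {B \<in> lift_family T i. S \<subseteq> B} \<le> 1"
    if S: "S \<subseteq> Inl ` V" "card S = t" and i: "i \<in> {1..\<mu>}" for S i
  proof -
    obtain R where R: "R \<subseteq> V" "S = Inl ` R" "card R = t" using pull S by blast
    then show ?thesis
      unfolding R(2) card_lift_family_filter
      using sb i unfolding solely_balanced_def mu_way_steiner_trade_def by blast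
  qed
  have solely: False
    if ij: "1 \<le> i" "i < j" "j \<le> \<mu>" and S: "S \<subseteq> Inl ` V" "card S = t + 1"
      and BC: "B \<in> lift_family T i" "S \<subseteq> B" "C \<in> lift_family T j" "S \<subseteq> C" for i j S B C
  proof -
    obtain R where R: "R \<subseteq> V" "S = Inl ` R" "card R = t + 1" using pull S by metis
    obtain B' C' where "B' \<in> T i" "B = Inl ` B'" "C' \<in> T j" "C = Inl ` C'"
      using BC unfolding lift_family_def by blast
    \<comment> \<open>Containment pulls back along \<open>Inl\<close>, so \<open>R\<close> would lie
      in blocks of two collections of \<open>T\<close>, against sole balance.\<close>
    moreover from this have "R \<subseteq> B'" "R \<subseteq> C'" using BC R(2) by (auto simp: inj_image_subset_iff)
    ultimately show False using sb ij R(1,3) unfolding solely_balanced_def by blast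
  qed
  have trade: "mu_way_trade \<mu> v k t m (Inl ` V) (lift_family T)"
    using sb unfolding solely_balanced_def mu_way_steiner_trade_def
    by (intro lift_family_is_trade) (elim conjE)
  show ?thesis
    unfolding solely_balanced_def mu_way_steiner_trade_def
  proof (intro conjI trade allI impI ballI notI)
    show "card {B \<in> lift_family T i. S \<subseteq> B} \<le> 1"
      if "S \<subseteq> Inl ` V \<and> card S = t" "i \<in> {1..\<mu>}" for S i
      using steiner that by blast
    show False
      if "1 \<le> i \<and> i < j \<and> j \<le> \<mu>"
        and ex: "\<exists>S. S \<subseteq> Inl ` V \<and> card S = t + 1 \<and>
          (\<exists>B\<in>lift_family T i. S \<subseteq> B) \<and> (\<exists>C\<in>lift_family T j. S \<subseteq> C)" for i j
    proof -
      obtain S B C where "S \<subseteq> Inl ` V" "card S = t + 1"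
        "B \<in> lift_family T i" "S \<subseteq> B" "C \<in> lift_family T j" "S \<subseteq> C"
        using ex by blast
      then show False using solely[of i j S B C] that(1) by blast
    qed
  qed
qed

text \<open>The first conjunct treats every choice of new elements within the given type; the second
  guarantees that a choice exists after enlarging the type.\<close>

theorem theorem2p2:
  fixes V :: "'a set" and T :: "nat \<Rightarrow> 'a set set" and \<mu> v k t m :: nat
  assumes "mu_way_trade \<mu> v k t m V T"
  shows
    "(\<forall>x :: nat \<Rightarrow> 'a. new_elements \<mu> V x \<longrightarrow>
        mu_way_trade \<mu> (v + \<mu>) (k + 1) (t + 1) (\<mu> * m)
          (V \<union> x ` {1..\<mu>}) (star_trade \<mu> x T) \<and>
        (solely_balanced \<mu> v k t m V T \<longrightarrow>
          mu_way_steiner_trade \<mu> (v + \<mu>) (k + 1) (t + 1) (\<mu> * m)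
            (V \<union> x ` {1..\<mu>}) (star_trade \<mu> x T))) \<and>
     (\<exists>x :: nat \<Rightarrow> 'a + nat. new_elements \<mu> (Inl ` V) x \<and>
        mu_way_trade \<mu> (v + \<mu>) (k + 1) (t + 1) (\<mu> * m)
          (Inl ` V \<union> x ` {1..\<mu>}) (star_trade \<mu> x (lift_family T)) \<and>
        (solely_balanced \<mu> v k t m V T \<longrightarrow>
          mu_way_steiner_trade \<mu> (v + \<mu>) (k + 1) (t + 1) (\<mu> * m)
            (Inl ` V \<union> x ` {1..\<mu>}) (star_trade \<mu> x (lift_family T))))"
proof (intro conjI allI impI)
  fix x :: "nat \<Rightarrow> 'a"
  assume x: "new_elements \<mu> V x"
  show "mu_way_trade \<mu> (v + \<mu>) (k + 1) (t + 1) (\<mu> * m)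
      (V \<union> x ` {1..\<mu>}) (star_trade \<mu> x T)"
    using star_trade_is_trade[OF assms x] .
  show "mu_way_steiner_trade \<mu> (v + \<mu>) (k + 1) (t + 1) (\<mu> * m)
      (V \<union> x ` {1..\<mu>}) (star_trade \<mu> x T)" if "solely_balanced \<mu> v k t m V T"
    using star_trade_is_steiner[OF that x] .
next
  \<comment> \<open>The right summand supplies the witness: \<open>Inr\<close> is injective and its
    range is disjoint from that of \<open>Inl\<close>.\<close>
  have "new_elements \<mu> (Inl ` V) (Inr :: nat \<Rightarrow> 'a + nat)"
    unfolding new_elements_def by auto
  then show "\<exists>x :: nat \<Rightarrow> 'a + nat. new_elements \<mu> (Inl ` V) x \<and>
      mu_way_trade \<mu> (v + \<mu>) (k + 1) (t + 1) (\<mu> * m)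
        (Inl ` V \<union> x ` {1..\<mu>}) (star_trade \<mu> x (lift_family T)) \<and>
      (solely_balanced \<mu> v k t m V T \<longrightarrow>
        mu_way_steiner_trade \<mu> (v + \<mu>) (k + 1) (t + 1) (\<mu> * m)
          (Inl ` V \<union> x ` {1..\<mu>}) (star_trade \<mu> x (lift_family T)))"
    using star_trade_is_trade[OF lift_family_is_trade[OF assms]]
      star_trade_is_steiner[OF lift_family_solely_balanced] by blast
qed

end
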